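(* Let $\alpha \in \overline{-\mathbb{H}}$, let $U \subset \mathbb{C}$ be a simply connected domain containing $\overline{\mathbb{H}} \setminus \{\alpha\}$, and let $f : U \to \mathbb{C}$ be an injective holomorphic function such that $f(\overline{\mathbb{H}} \setminus \{\alpha\})$ is convex. Let $(X_i)_{i \ge 1}$ be i.i.d. real-valued continuous random variables. Identify $\mathbb{C}$ with $\mathbb{R}^2$. If $E[|f(X_1)|^2] < +\infty$, then, as $n \to \infty$, \[ \sqrt{n} \left( f^{-1}\left( \frac{1}{n} \sum_{j=1}^{n} f(X_j) \right) - f^{-1}(E[f(X_1)]) \right) \Rightarrow N\left(0, J(f^{-1})\, \mathrm{Cov}(f(X_1))\, J(f^{-1})^{\prime} \right), \] where $\Rightarrow$ denotes convergence in distribution, $N(\cdot,\cdot)$ is the two-dimensional normal distribution, $J(f^{-1})$ is the $2\times 2$ Jacobi matrix of $f^{-1}$ (viewed as a map between subsets of $\mathbb{R}^2$) at the point $E[f(X_1)]$, $J(f^{-1})^{\prime}$ is its transpose, and $\mathrm{Cov}(f(X_1))$ is the covariance matrix of the $\mathbb{R}^2$-valued random variable $(\mathrm{Re} f(X_1), \mathrm{Im} f(X_1))$.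
   Context: $\overline{\mathbb{H}} = \{x+yi : x \in \mathbb{R},\, y \ge 0\}$ and $\overline{-\mathbb{H}} = \{x+yi : x \in \mathbb{R},\, y \le 0\}$. If $\alpha \notin \mathbb{R}$, then $\overline{\mathbb{H}} \setminus \{\alpha\} = \overline{\mathbb{H}}$. The map $f^{-1} : f(U) \to U$ is the (holomorphic) inverse of $f$. A real-valued random variable $X$ is called continuous if $P(X = x) = 0$ for every $x \in \mathbb{R}$ (so $f(X_j)$ is defined almost surely). For a complex-valued random variable $Y$, $E[Y] := E[\mathrm{Re}(Y)] + i E[\mathrm{Im}(Y)]$. The normal distribution may be degenerate. *)

theory Defs
  imports "HOL-Complex_Analysis.Complex_Analysis" "HOL-Probability.Probability"
begin

no_notation fps_nth (infixl "$" 75)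

definition vec_of_complex :: "complex \<Rightarrow> real^2" where
  "vec_of_complex z = vector [Re z, Im z]"

definition complex_of_vec :: "real^2 \<Rightarrow> complex" where
  "complex_of_vec v = Complex (v $ 1) (v $ 2)"

lemma complex_of_vec_of_complex [simp]: "complex_of_vec (vec_of_complex z) = z"
  by (simp add: complex_of_vec_def vec_of_complex_def)

lemma vec_of_complex_of_vec [simp]: "vec_of_complex (complex_of_vec v) = v"
  by (simp add: complex_of_vec_def vec_of_complex_def vec_eq_iff forall_2)

definition covariance_matrix :: "'a measure \<Rightarrow> ('a \<Rightarrow> real^'n) \<Rightarrow> real^'n^'n" where
  "covariance_matrix M Y =
     (\<chi> i j. \<integral>\<omega>. (Y \<omega> $ i - (\<integral>\<omega>'. Y \<omega>' $ i \<partial>M)) * (Y \<omega> $ j - (\<integral>\<omega>'. Y \<omega>' $ j \<partial>M)) \<partial>M)"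

text \<open>
  The distribution of \<open>m + A Z\<close>, where \<open>Z\<close> has independent standard normal components and
  \<open>A\<close> is a square matrix with \<open>A A' = S\<close>. Such an \<open>A\<close> exists iff \<open>S\<close> is symmetric positive
  semidefinite; a singular \<open>S\<close> gives a degenerate normal distribution. The result does not
  depend on the choice of \<open>A\<close>: lemma \<open>char_multivariate_normal\<close> below expresses its characteristic
  function in terms of \<open>m\<close> and \<open>S\<close> alone.
\<close>

definition multivariate_normal :: "real^'n \<Rightarrow> real^'n^'n \<Rightarrow> (real^'n) measure" where
  "multivariate_normal m S =
     (let A = (SOME A :: real^'n^'n. A ** transpose A = S) in
      distr (\<Pi>\<^sub>M i\<in>UNIV. std_normal_distribution) borel (\<lambda>z. m + A *v (\<chi> i. z i)))"

definition converges_in_distribution ::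
    "'a measure \<Rightarrow> (nat \<Rightarrow> 'a \<Rightarrow> 'b::metric_space) \<Rightarrow> 'b measure \<Rightarrow> bool" where
  "converges_in_distribution M Y N \<longleftrightarrow>
     (\<forall>n. Y n \<in> borel_measurable M) \<and>
     (\<forall>g::'b \<Rightarrow> real. continuous_on UNIV g \<longrightarrow> bounded (range g) \<longrightarrow>
        (\<lambda>n. \<integral>\<omega>. g (Y n \<omega>) \<partial>M) \<longlonglongrightarrow> (\<integral>y. g y \<partial>N))"

lemma measurable_normal_vector:
  fixes A :: "real^'n^'n"
  shows "(\<lambda>z. m + A *v (\<chi> i. z i)) \<in> (\<Pi>\<^sub>M i\<in>UNIV. std_normal_distribution) \<rightarrow>\<^sub>M borel"
proof -
  have "(\<lambda>z. (m + A *v (\<chi> i. z i)) \<bullet> b) \<in> borel_measurable (\<Pi>\<^sub>M i\<in>UNIV. std_normal_distribution)"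
    for b :: "real^'n"
    unfolding inner_vec_def matrix_vector_mult_def
    by (simp add: measurable_component_singleton)
  then show ?thesis
    by (subst borel_measurable_euclidean_space) blast
qed

lemma char_multivariate_normal:
  fixes t m :: "real^'n" and S A0 :: "real^'n^'n"
  assumes "A0 ** transpose A0 = S"
  shows "(CLINT x|multivariate_normal m S. iexp (t \<bullet> x))
           = exp (\<i> * of_real (t \<bullet> m) - of_real ((t \<bullet> (S *v t)) / 2))"
proof -
  let ?P = "\<Pi>\<^sub>M i\<in>(UNIV::'n set). std_normal_distribution"
  define A where "A = (SOME A :: real^'n^'n. A ** transpose A = S)"
  have A: "A ** transpose A = S"
    unfolding A_def by (rule someI) (rule assms)
  define u where "u = transpose A *v t"
  interpret std: real_distribution std_normal_distribution
    by (rule real_dist_normal_dist)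
  interpret product_sigma_finite "\<lambda>i::'n. std_normal_distribution"
    by standard
  have "(CLINT x|multivariate_normal m S. iexp (t \<bullet> x))
          = (\<integral>z. iexp (t \<bullet> (m + A *v (\<chi> i. z i))) \<partial>?P)"
    unfolding multivariate_normal_def A_def[symmetric] Let_def
    by (rule integral_distr) (use measurable_normal_vector in auto)
  also have "\<dots> = (\<integral>z. iexp (t \<bullet> m) * (\<Prod>i\<in>UNIV. iexp (u $ i * z i)) \<partial>?P)"
  proof (rule Bochner_Integration.integral_cong[OF refl])
    fix z :: "'n \<Rightarrow> real"
    have "t \<bullet> (A *v (\<chi> i. z i)) = u \<bullet> (\<chi> i. z i)"
      by (simp only: u_def transpose_matrix_vector dot_lmul_matrix)
    also have "\<dots> = (\<Sum>i\<in>UNIV. u $ i * z i)"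
      by (simp add: inner_vec_def)
    finally have "t \<bullet> (m + A *v (\<chi> i. z i)) = t \<bullet> m + (\<Sum>i\<in>UNIV. u $ i * z i)"
      by (simp add: inner_right_distrib)
    then have "\<i> * of_real (t \<bullet> (m + A *v (\<chi> i. z i)))
        = \<i> * of_real (t \<bullet> m) + (\<Sum>i\<in>UNIV. \<i> * of_real (u $ i * z i))"
      by (simp add: sum_distrib_left distrib_left)
    then show "iexp (t \<bullet> (m + A *v (\<chi> i. z i))) = iexp (t \<bullet> m) * (\<Prod>i\<in>UNIV. iexp (u $ i * z i))"
      by (simp only: exp_add exp_sum finite)
  qed
  also have "\<dots> = iexp (t \<bullet> m) * (\<integral>z. (\<Prod>i\<in>UNIV. iexp (u $ i * z i)) \<partial>?P)"
    by simp
  also have "(\<integral>z. (\<Prod>i\<in>UNIV. iexp (u $ i * z i)) \<partial>?P)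
               = (\<Prod>i\<in>UNIV. char std_normal_distribution (u $ i))"
    unfolding char_def
    by (rule product_integral_prod) (auto intro!: std.integrable_iexp)
  also have "\<dots> = of_real (exp (- (u \<bullet> u) / 2))"
  proof -
    have "(\<Prod>i\<in>UNIV. exp (- (u $ i)\<^sup>2 / 2)) = exp (\<Sum>i\<in>UNIV. - (u $ i)\<^sup>2 / 2)"
      by (rule exp_sum[symmetric]) simp
    also have "(\<Sum>i\<in>UNIV. - (u $ i)\<^sup>2 / 2) = - (u \<bullet> u) / 2"
      by (simp add: inner_vec_def power2_eq_square sum_negf sum_divide_distrib)
    finally show ?thesis
      by (simp only: char_std_normal_distribution of_real_prod[symmetric])
  qed
  also have "u \<bullet> u = t \<bullet> (S *v t)"
    by (simp only: u_def A[symmetric] matrix_vector_mul_assoc[symmetric] transpose_matrix_vector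
        dot_lmul_matrix)
  finally show ?thesis
    by (simp only: exp_of_real[symmetric] exp_add[symmetric]) simp
qed

end

theory Submission
  imports Defs
begin

text \<open>
  The convex set \<open>C = f(H)\<close>, with \<open>H\<close> the closed upper half-plane without \<open>\<alpha>\<close>, contains \<open>f(X\<^sub>1)\<close>
  almost surely, hence also the mean \<open>m = E f(X\<^sub>1)\<close>: a supporting hyperplane at a mean outside \<open>C\<close>
  would carry the whole distribution, and one descends in dimension. So \<open>f\<^sup>-\<^sup>1\<close> is differentiable at
  \<open>m\<close>, and the claim is the delta method applied to the central limit theorem for
  \<open>f(X\<^sub>j)\<close> in the plane. Both rest on Levy's continuity theorem in Euclidean space: characters span an
  algebra that approximates bounded continuous functions on balls, and tightness follows coordinatewise
  from the one-dimensional theorem.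
\<close>

text \<open>The set \<open>C\<close> need not be closed: for \<open>\<alpha> = 0\<close>, a square
  root with its cut along the negative imaginary axis maps \<open>H\<close> onto the closed first
  quadrant without its corner. Weak separation of the mean from \<open>C\<close> is all that is
  available, and this is what forces the descent in dimension. Once the mean lies in the open image
  of \<open>U\<close>, the delta method sees the inverse only through its derivative there; far from
  the mean, Borel measurability of \<open>inv_into U f\<close> on the whole plane is enough. The
  covariance may be singular, so the limits are identified by characters and not by densities, and
  projections of variance zero are treated separately. Since \<open>multivariate_normal\<close>
  picks its matrix root by \<open>SOME\<close>, a root must be exhibited, both for the covariance
  \<open>S\<close> and for \<open>J ** S ** transpose J\<close>, before the characters of these laws
  can be computed.\<close>

section \<open>Means in convex sets, and independence under reindexing\<close>

lemma (in prob_space) expectation_in_convex: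
  fixes Y :: "'a \<Rightarrow> 'b::euclidean_space"
  assumes "integrable M Y" and "convex C" and "AE \<omega> in M. Y \<omega> \<in> C"
  shows "expectation Y \<in> C"
  using assms(2,3)
\<comment> \<open>The dimension is that of \<open>C\<close> together with the mean, because the
  separating direction below is found in this joint affine hull.\<close>
proof (induction "nat (aff_dim (insert (expectation Y) C) + 1)" arbitrary: C rule: less_induct)
  case less
  let ?m = "expectation Y"
  note [measurable] = borel_measurable_integrable[OF assms(1)]
  show ?case
  proof (rule ccontr)
    assume notin: "?m \<notin> C"
    have "C \<noteq> {}"
      using less.prems(2) by auto
    with less.prems(1) notin obtain a b
      \<comment> \<open>That \<open>?m + a\<close> stays in the affine hull is the point: it lies
        off the hyperplane through \<open>?m\<close> orthogonal to \<open>a\<close>, so cutting with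
        this hyperplane strictly lowers the dimension.\<close>
      where ab: "?m + a \<in> affine hull (insert ?m C)" "a \<noteq> 0" "a \<bullet> ?m \<le> b"
        "\<And>x. x \<in> C \<Longrightarrow> a \<bullet> x \<ge> b"
      by (metis separating_hyperplane_set_point_inaff)
    have nonneg: "AE \<omega> in M. 0 \<le> a \<bullet> (Y \<omega> - ?m)"
      using less.prems(2) ab(3,4) by (auto elim!: eventually_mono simp: inner_diff_right intro: order_trans)
    have "expectation (\<lambda>\<omega>. a \<bullet> (Y \<omega> - ?m)) = 0"
      using assms(1) by (simp add: prob_space)
    then have "AE \<omega> in M. a \<bullet> (Y \<omega> - ?m) = 0"
      using nonneg assms(1) by (subst (asm) integral_nonneg_eq_0_iff_AE) auto
    then have AE_hyp: "AE \<omega> in M. Y \<omega> \<in> C \<inter> {x. a \<bullet> x = a \<bullet> ?m}"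
      using less.prems(2) by eventually_elim (simp add: inner_diff_right)
    let ?D = "C \<inter> {x. a \<bullet> x = a \<bullet> ?m}"
    have sub: "affine hull (insert ?m ?D) \<subseteq> {x. a \<bullet> x = a \<bullet> ?m}"
      by (rule hull_minimal) (auto simp: affine_hyperplane)
    have "?m + a \<notin> affine hull (insert ?m ?D)"
      using sub ab(2) by (auto simp: inner_add_right)
    with ab(1) have "affine hull (insert ?m ?D) \<subset> affine hull (insert ?m C)"
      using hull_mono[of "insert ?m ?D" "insert ?m C" affine] by blast
    then have "aff_dim (insert ?m ?D) < aff_dim (insert ?m C)"
      by (rule aff_dim_psubset)
    moreover have "aff_dim (insert ?m ?D) \<ge> -1"
      by (rule aff_dim_geq)
    ultimately have "nat (aff_dim (insert ?m ?D) + 1) < nat (aff_dim (insert ?m C) + 1)"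
      by linarith
    from less.hyps[OF this] have "?m \<in> ?D"
      using AE_hyp less.prems(1) by (auto intro!: convex_Int convex_hyperplane)
    with notin show False
      by blast
  qed
qed

text \<open>Bridges the indexing of the samples from 1 and that of the limit theorems from 0. A
  finite family over \<open>J\<close> is carried to the image of \<open>J\<close> by
  \<open>inv_into J f\<close>, and injectivity keeps the product of probabilities unchanged.\<close>

lemma (in prob_space) indep_vars_reindex:
  assumes indep: "indep_vars N X (f ` I)" and inj: "inj_on f I"
  shows "indep_vars (\<lambda>i. N (f i)) (\<lambda>i. X (f i)) I"
proof -
  let ?F = "\<lambda>i. {X i -` A \<inter> space M |A. A \<in> sets (N i)}"
  have indep_sets_prod: "prob (\<Inter>k\<in>K. B k) = (\<Prod>k\<in>K. prob (B k))"
    if "B \<in> Pi K ?F" "K \<subseteq> f ` I" "K \<noteq> {}" "finite K" for K B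
    using indep that unfolding indep_vars_def2 indep_sets_def by blast
  have "indep_sets (\<lambda>i. ?F (f i)) I"
    unfolding indep_sets_def
  proof (intro conjI allI ballI impI)
    fix i assume "i \<in> I"
    then show "?F (f i) \<subseteq> events"
      using indep unfolding indep_vars_def2 indep_sets_def by blast
  next
    fix J A assume J: "J \<subseteq> I" "J \<noteq> {}" "finite J" and A: "A \<in> (\<Pi> i\<in>J. ?F (f i))"
    let ?g = "inv_into J f"
    have inj_J: "inj_on f J"
      using inj J(1) by (rule inj_on_subset)
    then have g: "?g (f j) = j" if "j \<in> J" for j
      using that by simp
    have "prob (\<Inter>k\<in>f ` J. A (?g k)) = (\<Prod>k\<in>f ` J. prob (A (?g k)))"
    proof (rule indep_sets_prod)
      show "(\<lambda>k. A (?g k)) \<in> Pi (f ` J) ?F"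
        using A g by (auto simp: Pi_iff)
    qed (use J in auto)
    then show "prob (\<Inter>j\<in>J. A j) = (\<Prod>j\<in>J. prob (A j))"
      using g inj_J by (simp add: prod.reindex)
  qed
  then show ?thesis
    using indep unfolding indep_vars_def2 by auto
qed

section \<open>Approximation by trigonometric polynomials\<close>

text \<open>The free phase \<open>s\<close> absorbs the sines, so a single kind of generator yields
  all real parts of linear combinations of characters, and products reduce to the product formula
  for cosines.\<close>

inductive trig_polynomial :: "('b::real_inner \<Rightarrow> real) \<Rightarrow> bool" where
  cos: "trig_polynomial (\<lambda>x. c * cos (t \<bullet> x + s))"
| add: "trig_polynomial p \<Longrightarrow> trig_polynomial q \<Longrightarrow> trig_polynomial (\<lambda>x. p x + q x)"

lemma trig_polynomial_const: "trig_polynomial (\<lambda>x. c)"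
  using trig_polynomial.cos[of c 0 0] by simp

lemma trig_polynomial_mult_cos:
  assumes "trig_polynomial p"
  shows "trig_polynomial (\<lambda>x. (c * cos (t \<bullet> x + s)) * p x)"
  using assms
proof induction
  case (cos c' t' s')
  have "(c * cos (t \<bullet> x + s)) * (c' * cos (t' \<bullet> x + s'))
      = c * c' / 2 * cos ((t - t') \<bullet> x + (s - s')) + c * c' / 2 * cos ((t + t') \<bullet> x + (s + s'))" for x
  proof -
    have "(t \<bullet> x + s) - (t' \<bullet> x + s') = (t - t') \<bullet> x + (s - s')"
      "(t \<bullet> x + s) + (t' \<bullet> x + s') = (t + t') \<bullet> x + (s + s')"
      by (simp_all add: inner_diff_left inner_add_left)
    then have "cos (t \<bullet> x + s) * cos (t' \<bullet> x + s')
        = (cos ((t - t') \<bullet> x + (s - s')) + cos ((t + t') \<bullet> x + (s + s'))) / 2"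
      by (simp only: cos_times_cos)
    then show ?thesis
      by (simp add: field_simps)
  qed
  then show ?case
    by (simp only: trig_polynomial.intros)
next
  case (add p q)
  then show ?case
    by (simp only: distrib_left trig_polynomial.add)
qed

lemma trig_polynomial_mult:
  assumes "trig_polynomial p" "trig_polynomial q"
  shows "trig_polynomial (\<lambda>x. p x * q x)"
  using assms
proof induction
  case (cos c t s)
  then show ?case
    by (rule trig_polynomial_mult_cos)
next
  case (add p q)
  then show ?case
    by (simp only: distrib_right trig_polynomial.add)
qed

lemma trig_polynomial_continuous: "trig_polynomial p \<Longrightarrow> continuous_on S p"
  by (induction rule: trig_polynomial.induct) (auto intro!: continuous_intros)

lemma trig_polynomial_bounded:
  assumes "trig_polynomial p"
  shows "\<exists>C. \<forall>x. \<bar>p x\<bar> \<le> C"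
  using assms
proof induction
  case (cos c t s)
  have "\<bar>c * cos (t \<bullet> x + s)\<bar> \<le> \<bar>c\<bar>" for x
    using abs_cos_le_one[of "t \<bullet> x + s"] by (simp add: abs_mult mult_left_le)
  then show ?case
    by blast
next
  case (add p q)
  then obtain C D where "\<bar>p x\<bar> \<le> C" "\<bar>q x\<bar> \<le> D" for x
    by metis
  then have "\<bar>p x + q x\<bar> \<le> C + D" for x
    by (meson abs_triangle_ineq add_mono order_trans)
  then show ?case
    by blast
qed

lemma trig_polynomial_compose_polynomial:
  fixes q :: "real \<Rightarrow> real"
  assumes "real_polynomial_function q" "trig_polynomial p"
  shows "trig_polynomial (\<lambda>x. q (p x))"
  using assms
proof induction
  case (linear f)
  then obtain c where "f = (\<lambda>x. x * c)"
    using real_bounded_linear by blast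
  with linear show ?case
    by (simp add: trig_polynomial_mult trig_polynomial_const)
qed (auto intro: trig_polynomial_const trig_polynomial.add trig_polynomial_mult)

lemma trig_polynomial_separates:
  fixes x y :: "'b::real_inner"
  assumes "x \<noteq> y"
  shows "\<exists>p. trig_polynomial p \<and> p x \<noteq> p y"
proof -
  \<comment> \<open>Scaled so that \<open>t \<bullet> (y - x) = 1\<close>. With the phase
    \<open>- (t \<bullet> x)\<close> the cosine has argument 0 at \<open>x\<close> and 1 at
    \<open>y\<close>.\<close>
  define t where "t = (y - x) /\<^sub>R (norm (y - x))\<^sup>2"
  have "t \<bullet> (y - x) = 1"
    using assms by (simp add: t_def power2_norm_eq_inner)
  then have "t \<bullet> y - t \<bullet> x = 1"
    by (simp only: inner_diff_right)
  moreover have "cos (1::real) \<noteq> 1"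
    using cos_one_2pi[of 1] pi_gt3 cos_monotone_0_pi[of 0 1] by auto
  ultimately have "1 * cos (t \<bullet> x + - (t \<bullet> x)) \<noteq> 1 * cos (t \<bullet> y + - (t \<bullet> x))"
    by simp
  then show ?thesis
    using trig_polynomial.cos[of 1 t "- (t \<bullet> x)"] by blast
qed

text \<open>Stone--Weierstrass controls the approximant only on the ball. Composing it with a polynomial
  close to the truncation at height \<open>B\<close> bounds it on the whole space.\<close>

lemma trig_polynomial_approx:
  fixes g :: "'b::euclidean_space \<Rightarrow> real"
  assumes cont: "continuous_on UNIV g" and bound: "\<And>x. \<bar>g x\<bar> \<le> B" and "0 < e"
  obtains r where "trig_polynomial r" "\<And>x. \<bar>r x\<bar> \<le> B + e"
    "\<And>x. norm x \<le> K \<Longrightarrow> \<bar>g x - r x\<bar> \<le> e"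
proof -
  interpret function_ring_on "Collect trig_polynomial" "cball (0::'b) K"
    by unfold_locales
      (use trig_polynomial_separates in \<open>auto intro: trig_polynomial_continuous trig_polynomial.add
        trig_polynomial_mult trig_polynomial_const\<close>)
  obtain p where p: "trig_polynomial p" "\<And>x. norm x \<le> K \<Longrightarrow> \<bar>g x - p x\<bar> < e / 2"
    using Stone_Weierstrass_basic[of g "e / 2"] continuous_on_subset[OF cont] \<open>0 < e\<close>
    by auto
  obtain C where C: "\<And>x. \<bar>p x\<bar> \<le> C"
    using trig_polynomial_bounded[OF p(1)] by blast
  define clip where "clip y = max (- B) (min B y)" for y :: real
  have "continuous_on {-C..C} clip"
    unfolding clip_def by (intro continuous_intros)
  then obtain q where q: "real_polynomial_function q"
      "\<And>y. y \<in> {-C..C} \<Longrightarrow> \<bar>clip y - q y\<bar> < e / 2"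
    using Stone_Weierstrass_real_polynomial_function[of "{-C..C}" clip "e / 2"] \<open>0 < e\<close> by auto
  have q_clip: "\<bar>clip (p x) - q (p x)\<bar> < e / 2" for x
    using C[of x] by (intro q(2)) auto
  show ?thesis
  proof
    show "trig_polynomial (\<lambda>x. q (p x))"
      using q(1) p(1) by (rule trig_polynomial_compose_polynomial)
    show "\<bar>q (p x)\<bar> \<le> B + e" for x
      using q_clip[of x] bound[of x] \<open>0 < e\<close> unfolding clip_def by linarith
    \<comment> \<open>Since \<open>g\<close> takes values in \<open>{-B..B}\<close>, clipping
      \<open>p x\<close> to this interval cannot move it away from \<open>g x\<close>; the two
      errors \<open>e / 2\<close> add up.\<close>
    show "\<bar>g x - q (p x)\<bar> \<le> e" if "norm x \<le> K" for x
      using p(2)[OF that] q_clip[of x] bound[of x] unfolding clip_def by linarith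
  qed
qed

section \<open>Tightness\<close>

lemma (in prob_space) tight_random_vector:
  fixes Z :: "'a \<Rightarrow> 'b::real_normed_vector"
  assumes [measurable]: "Z \<in> borel_measurable M" and "0 < e"
  obtains K where "prob {\<omega> \<in> space M. K < norm (Z \<omega>)} < e"
proof -
  let ?A = "\<lambda>k::nat. {\<omega> \<in> space M. real k < norm (Z \<omega>)}"
  have "(\<lambda>k. prob (?A k)) \<longlonglongrightarrow> prob (\<Inter>k. ?A k)"
    by (rule finite_Lim_measure_decseq) (auto simp: decseq_def)
  moreover have "(\<Inter>k. ?A k) = {}"
    using reals_Archimedean2 by (auto dest: less_asym)
  ultimately have "\<forall>\<^sub>F k in sequentially. prob (?A k) < e"
    using \<open>0 < e\<close> by (auto intro: order_tendstoD)
  then show ?thesis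
    using that by (auto simp: eventually_sequentially)
qed

lemma (in prob_space) converges_in_distribution_tight:
  fixes Y :: "nat \<Rightarrow> 'a \<Rightarrow> 'b::euclidean_space"
  assumes conv: "converges_in_distribution M Y N"
    and N: "prob_space N" "sets N = sets borel" and "0 < e"
  obtains K where "\<forall>\<^sub>F n in sequentially. prob {\<omega> \<in> space M. K < norm (Y n \<omega>)} < e"
proof -
  interpret N: prob_space N by fact
  note [measurable_cong] = N(2)
  have [measurable]: "Y n \<in> borel_measurable M" for n
    using conv by (simp add: converges_in_distribution_def)
  obtain K where K: "N.prob {x \<in> space N. K < norm (x::'b)} < e"
    using N.tight_random_vector[of "\<lambda>x. x" e] \<open>0 < e\<close> by auto
  \<comment> \<open>A continuous ramp between the indicators of \<open>K + 1 < norm x\<close> and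
    \<open>K < norm x\<close>. It is an admissible test function, bounded by the tail of the limit
    and dominating the tail of \<open>Y n\<close> at a radius larger by one.\<close>
  define h where "h x = min 1 (max 0 (norm x - K))" for x :: 'b
  have h: "0 \<le> h x" "h x \<le> 1" "h x \<le> indicator {x. K < norm x} x" "indicator {x. K + 1 < norm x} x \<le> h x" for x
    by (auto simp: h_def indicator_def)
  have h_cont: "continuous_on UNIV h"
    unfolding h_def by (intro continuous_intros)
  then have [measurable]: "h \<in> borel_measurable borel"
    by (rule borel_measurable_continuous_onI)
  have "bounded (range h)"
    using h(1,2) by (auto intro!: boundedI[of _ 1] simp: abs_of_nonneg)
  with conv h_cont have "(\<lambda>n. expectation (\<lambda>\<omega>. h (Y n \<omega>))) \<longlonglongrightarrow> N.expectation h"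
    by (simp add: converges_in_distribution_def)
  moreover have "N.expectation h < e"
  proof -
    have "N.expectation h \<le> N.expectation (indicator {x \<in> space N. K < norm x})"
    proof (rule integral_mono)
      show "integrable N h"
        using h by (intro N.integrable_const_bound[of _ 1]) auto
      show "integrable N (indicator {x \<in> space N. K < norm x} :: 'b \<Rightarrow> real)"
        by (intro N.integrable_const_bound[of _ 1]) auto
      show "h x \<le> indicator {x \<in> space N. K < norm x} x" if "x \<in> space N" for x
        using h(3)[of x] that by (auto simp: indicator_def)
    qed
    with K show ?thesis by simp
  qed
  ultimately have "\<forall>\<^sub>F n in sequentially. expectation (\<lambda>\<omega>. h (Y n \<omega>)) < e"
    by (rule order_tendstoD)
  moreover have "prob {\<omega> \<in> space M. K + 1 < norm (Y n \<omega>)} \<le> expectation (\<lambda>\<omega>. h (Y n \<omega>))" for n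
  proof -
    have "expectation (indicator {\<omega> \<in> space M. K + 1 < norm (Y n \<omega>)}) \<le> expectation (\<lambda>\<omega>. h (Y n \<omega>))"
    proof (rule integral_mono)
      show "integrable M (\<lambda>\<omega>. h (Y n \<omega>))"
        using h by (intro integrable_const_bound[of _ 1]) auto
      show "integrable M (indicator {\<omega> \<in> space M. K + 1 < norm (Y n \<omega>)} :: 'a \<Rightarrow> real)"
        by (intro integrable_const_bound[of _ 1]) auto
      show "indicator {\<omega> \<in> space M. K + 1 < norm (Y n \<omega>)} \<omega> \<le> h (Y n \<omega>)" if "\<omega> \<in> space M" for \<omega>
        using h(4)[of "Y n \<omega>"] that by (auto simp: indicator_def)
    qed
    then show ?thesis by simp
  qed
  ultimately have "\<forall>\<^sub>F n in sequentially. prob {\<omega> \<in> space M. K + 1 < norm (Y n \<omega>)} < e"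
    by (auto elim!: eventually_mono intro: le_less_trans)
  then show ?thesis
    by (rule that)
qed

section \<open>Characteristic functions and convergence in distribution\<close>

lemma (in prob_space) integral_cos_eq_Re_char:
  fixes Z :: "'a \<Rightarrow> 'b::euclidean_space"
  assumes [measurable]: "Z \<in> borel_measurable M"
  shows "expectation (\<lambda>\<omega>. c * cos (t \<bullet> Z \<omega> + s))
    = Re (of_real c * iexp s * (CLINT \<omega>|M. iexp (t \<bullet> Z \<omega>)))"
proof -
  have int: "integrable M (\<lambda>\<omega>. iexp (t \<bullet> Z \<omega>))"
    by (intro integrable_const_bound[of _ 1]) auto
  have "Re (of_real c * iexp s * iexp (t \<bullet> Z \<omega>)) = c * cos (t \<bullet> Z \<omega> + s)" for \<omega>
    by (simp add: Re_exp cos_add algebra_simps flip: exp_add)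
  then have "expectation (\<lambda>\<omega>. c * cos (t \<bullet> Z \<omega> + s))
      = expectation (\<lambda>\<omega>. Re (of_real c * iexp s * iexp (t \<bullet> Z \<omega>)))"
    by simp
  also have "\<dots> = Re (CLINT \<omega>|M. of_real c * iexp s * iexp (t \<bullet> Z \<omega>))"
    using int by (intro integral_Re) auto
  finally show ?thesis
    using int by simp
qed

lemma (in prob_space) integrable_trig_polynomial:
  fixes Z :: "'a \<Rightarrow> 'b::euclidean_space"
  assumes "trig_polynomial p" and [measurable]: "Z \<in> borel_measurable M"
  shows "integrable M (\<lambda>\<omega>. p (Z \<omega>))"
proof -
  obtain C where "\<And>x. \<bar>p x\<bar> \<le> C"
    using trig_polynomial_bounded[OF assms(1)] by blast
  moreover have [measurable]: "p \<in> borel_measurable borel"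
    using assms(1) by (intro borel_measurable_continuous_onI trig_polynomial_continuous)
  ultimately show ?thesis
    by (intro integrable_const_bound[of _ C]) auto
qed

lemma (in prob_space) trig_polynomial_expectation_tendsto:
  fixes Y :: "nat \<Rightarrow> 'a \<Rightarrow> 'b::euclidean_space"
  assumes Y: "\<And>n. Y n \<in> borel_measurable M"
    and N: "prob_space N" "sets N = sets borel"
    and char: "\<And>t. (\<lambda>n. CLINT \<omega>|M. iexp (t \<bullet> Y n \<omega>)) \<longlonglongrightarrow> (CLINT y|N. iexp (t \<bullet> y))"
    and "trig_polynomial p"
  shows "(\<lambda>n. expectation (\<lambda>\<omega>. p (Y n \<omega>))) \<longlonglongrightarrow> (\<integral>y. p y \<partial>N)"
proof -
  interpret N: prob_space N by fact
  have id: "(\<lambda>y. y) \<in> borel_measurable N"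
    using N(2) by (rule measurable_ident_sets)
  show ?thesis
    using \<open>trig_polynomial p\<close>
  proof induction
    case (cos c t s)
    show ?case
      unfolding integral_cos_eq_Re_char[OF Y] N.integral_cos_eq_Re_char[OF id]
      by (intro tendsto_intros char)
  next
    case (add p q)
    then show ?case
      using integrable_trig_polynomial[OF _ Y] N.integrable_trig_polynomial[OF _ id]
      by (simp add: tendsto_add)
  qed
qed

text \<open>The character of the projection \<open>b \<bullet> Y n\<close> at \<open>t\<close> is
  that of \<open>Y n\<close> at \<open>t *\<^sub>R b\<close>, so the one-dimensional continuity
  theorem applies to every projection. Tail bounds for the projections on a basis then combine to
  one for the norm.\<close>

lemma (in prob_space) char_convergence_tight:
  fixes Y :: "nat \<Rightarrow> 'a \<Rightarrow> 'b::euclidean_space"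
  assumes [measurable]: "\<And>n. Y n \<in> borel_measurable M"
    and N: "prob_space N" "sets N = sets borel"
    and char: "\<And>t. (\<lambda>n. CLINT \<omega>|M. iexp (t \<bullet> Y n \<omega>)) \<longlonglongrightarrow> (CLINT y|N. iexp (t \<bullet> y))"
    and "0 < e"
  obtains K where "\<forall>\<^sub>F n in sequentially. prob {\<omega> \<in> space M. K < norm (Y n \<omega>)} < e"
proof -
  interpret N: prob_space N by fact
  note [measurable_cong] = N(2)
  \<comment> \<open>The share of \<open>e\<close> for each coordinate in the union bound over
    \<open>Basis\<close>.\<close>
  define d where "d = e / real DIM('b)"
  have "d > 0"
    using \<open>0 < e\<close> by (simp add: d_def)
  have "\<exists>K. \<forall>\<^sub>F n in sequentially. prob {\<omega> \<in> space M. K < norm (b \<bullet> Y n \<omega>)} < d" for b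
  proof -
    let ?N = "distr N borel (\<lambda>x. b \<bullet> x)" and ?M = "\<lambda>n. distr M borel (\<lambda>\<omega>. b \<bullet> Y n \<omega>)"
    have N': "real_distribution ?N" and M': "real_distribution (?M n)" for n
      by (auto intro!: N.real_distribution_distr)
    have "(\<lambda>n. char (?M n) t) \<longlonglongrightarrow> char ?N t" for t
      using char[of "t *\<^sub>R b"] by (simp add: char_def integral_distr)
    then have weak: "weak_conv_m ?M ?N"
      by (intro levy_continuity M' N')
    \<comment> \<open>\<open>weak_conv_m\<close> speaks of distribution functions; it is restated
      with test functions so that \<open>converges_in_distribution_tight\<close> can be
      applied.\<close>
    have "converges_in_distribution M (\<lambda>n \<omega>. b \<bullet> Y n \<omega>) ?N"
      unfolding converges_in_distribution_def
    proof (intro conjI allI impI)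
      fix g :: "real \<Rightarrow> real" assume g: "continuous_on UNIV g" "bounded (range g)"
      then obtain B where "\<And>x. norm (g x) \<le> B"
        by (auto simp: bounded_iff)
      moreover have "isCont g x" for x
        using g(1) by (simp add: continuous_on_eq_continuous_at)
      ultimately have "(\<lambda>n. integral\<^sup>L (?M n) g) \<longlonglongrightarrow> integral\<^sup>L ?N g"
        by (intro weak_conv_imp_integral_bdd_continuous_conv M' N' weak)
      then show "(\<lambda>n. expectation (\<lambda>\<omega>. g (b \<bullet> Y n \<omega>))) \<longlonglongrightarrow> integral\<^sup>L ?N g"
        using borel_measurable_continuous_onI[OF g(1)] by (subst (asm) integral_distr) auto
    qed auto
    moreover have "prob_space ?N" "sets ?N = sets borel"
      using N' by (simp_all add: real_distribution_def)
    ultimately obtain K where "\<forall>\<^sub>F n in sequentially. prob {\<omega> \<in> space M. K < norm (b \<bullet> Y n \<omega>)} < d"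
      using \<open>d > 0\<close> by (rule converges_in_distribution_tight)
    then show ?thesis ..
  qed
  then have "\<exists>K. \<forall>b. \<forall>\<^sub>F n in sequentially. prob {\<omega> \<in> space M. K b < norm (b \<bullet> Y n \<omega>)} < d"
    by (intro choice allI)
  then obtain K where K: "\<And>b. \<forall>\<^sub>F n in sequentially. prob {\<omega> \<in> space M. K b < norm (b \<bullet> Y n \<omega>)} < d"
    by blast
  have "\<forall>\<^sub>F n in sequentially. \<forall>b\<in>Basis. prob {\<omega> \<in> space M. K b < norm (b \<bullet> Y n \<omega>)} < d"
    using K by (intro eventually_ball_finite) auto
  then have "\<forall>\<^sub>F n in sequentially. prob {\<omega> \<in> space M. (\<Sum>b\<in>Basis. K b) < norm (Y n \<omega>)} < e"
  proof eventually_elim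
    case (elim n)
    \<comment> \<open>The norm is at most the sum of the absolute coordinates, so it can exceed the
      sum of the \<open>K b\<close> only if some coordinate exceeds its own
      \<open>K b\<close>.\<close>
    have "{\<omega> \<in> space M. (\<Sum>b\<in>Basis. K b) < norm (Y n \<omega>)}
        \<subseteq> (\<Union>b\<in>Basis. {\<omega> \<in> space M. K b < norm (b \<bullet> Y n \<omega>)})"
    proof clarify
      fix \<omega> assume "\<omega> \<in> space M" and gt: "(\<Sum>b\<in>Basis. K b) < norm (Y n \<omega>)"
      have "norm (Y n \<omega>) \<le> (\<Sum>b\<in>Basis. norm (b \<bullet> Y n \<omega>))"
        using norm_le_l1[of "Y n \<omega>"] by (simp add: inner_commute)
      with gt have "\<not> (\<forall>b\<in>Basis. norm (b \<bullet> Y n \<omega>) \<le> K b)"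
        using sum_mono[of Basis "\<lambda>b. norm (b \<bullet> Y n \<omega>)" K] by fastforce
      with \<open>\<omega> \<in> space M\<close> show "\<omega> \<in> (\<Union>b\<in>Basis. {\<omega> \<in> space M. K b < norm (b \<bullet> Y n \<omega>)})"
        by (auto simp: not_le)
    qed
    then have "prob {\<omega> \<in> space M. (\<Sum>b\<in>Basis. K b) < norm (Y n \<omega>)}
        \<le> prob (\<Union>b\<in>Basis. {\<omega> \<in> space M. K b < norm (b \<bullet> Y n \<omega>)})"
      by (intro finite_measure_mono) auto
    also have "\<dots> \<le> (\<Sum>b\<in>Basis. prob {\<omega> \<in> space M. K b < norm (b \<bullet> Y n \<omega>)})"
      by (rule finite_measure_subadditive_finite) auto
    also have "\<dots> < (\<Sum>b\<in>(Basis :: 'b set). d)"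
      using elim by (intro sum_strict_mono) auto
    also have "\<dots> = e"
      by (simp add: d_def)
    finally show ?case .
  qed
  then show ?thesis
    by (rule that)
qed

lemma (in prob_space) expectation_approx_outside_ball:
  fixes Z :: "'a \<Rightarrow> 'b::euclidean_space" and g r :: "'b \<Rightarrow> real"
  assumes [measurable]: "Z \<in> borel_measurable M"
    and int: "integrable M (\<lambda>\<omega>. g (Z \<omega>))" "integrable M (\<lambda>\<omega>. r (Z \<omega>))"
    and bound: "\<And>x. \<bar>g x - r x\<bar> \<le> C" and inside: "\<And>x. norm x \<le> K \<Longrightarrow> \<bar>g x - r x\<bar> \<le> e"
    and "0 \<le> e"
  shows "\<bar>expectation (\<lambda>\<omega>. g (Z \<omega>)) - expectation (\<lambda>\<omega>. r (Z \<omega>))\<bar>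
    \<le> e + C * prob {\<omega> \<in> space M. K < norm (Z \<omega>)}"
proof -
  let ?A = "{\<omega> \<in> space M. K < norm (Z \<omega>)}"
  have "0 \<le> C"
    using bound[of 0] by linarith
  have int_A: "integrable M (indicator ?A :: 'a \<Rightarrow> real)"
    by (intro integrable_const_bound[of _ 1]) auto
  have "\<bar>expectation (\<lambda>\<omega>. g (Z \<omega>)) - expectation (\<lambda>\<omega>. r (Z \<omega>))\<bar>
      = \<bar>expectation (\<lambda>\<omega>. g (Z \<omega>) - r (Z \<omega>))\<bar>"
    using int by simp
  also have "\<dots> \<le> expectation (\<lambda>\<omega>. \<bar>g (Z \<omega>) - r (Z \<omega>)\<bar>)"
    by (rule integral_abs_bound)
  also have "\<dots> \<le> expectation (\<lambda>\<omega>. e + C * indicator ?A \<omega>)"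
  proof (rule integral_mono)
    show "integrable M (\<lambda>\<omega>. e + C * indicator ?A \<omega>)"
      using int_A by auto
    fix \<omega> assume "\<omega> \<in> space M"
    then show "\<bar>g (Z \<omega>) - r (Z \<omega>)\<bar> \<le> e + C * indicator ?A \<omega>"
      using bound[of "Z \<omega>"] inside[of "Z \<omega>"] \<open>0 \<le> C\<close> \<open>0 \<le> e\<close>
      by (cases "\<omega> \<in> ?A") auto
  qed (use int in auto)
  also have "\<dots> = e + C * prob ?A"
    using int_A by (simp add: prob_space)
  finally show ?thesis .
qed

theorem (in prob_space) levy_continuity_euclidean:
  fixes Y :: "nat \<Rightarrow> 'a \<Rightarrow> 'b::euclidean_space"
  assumes Y [measurable]: "\<And>n. Y n \<in> borel_measurable M"
    and N: "prob_space N" "sets N = sets borel"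
    and char: "\<And>t. (\<lambda>n. CLINT \<omega>|M. iexp (t \<bullet> Y n \<omega>)) \<longlonglongrightarrow> (CLINT y|N. iexp (t \<bullet> y))"
  shows "converges_in_distribution M Y N"
  unfolding converges_in_distribution_def
proof (intro conjI allI impI)
  interpret N: prob_space N by fact
  note [measurable_cong] = N(2)
  fix g :: "'b \<Rightarrow> real" assume g: "continuous_on UNIV g" "bounded (range g)"
  then obtain B where B: "\<And>x. \<bar>g x\<bar> \<le> B"
    by (auto simp: bounded_iff)
  have "0 \<le> B"
    using B[of 0] by linarith
  have [measurable]: "g \<in> borel_measurable borel"
    using g(1) by (rule borel_measurable_continuous_onI)
  have int_g: "integrable M (\<lambda>\<omega>. g (Y n \<omega>))" "integrable N g" for n
    using B by (auto intro!: integrable_const_bound[of _ B] N.integrable_const_bound[of _ B])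
  show "(\<lambda>n. expectation (\<lambda>\<omega>. g (Y n \<omega>))) \<longlonglongrightarrow> (\<integral>y. g y \<partial>N)"
  proof (rule tendstoI)
    fix \<epsilon> :: real assume "0 < \<epsilon>"
    \<comment> \<open>Replacing \<open>g\<close> by \<open>r\<close> costs at most
      \<open>\<eta>\<close> under each of the two laws, and the convergence for \<open>r\<close>
      costs less than \<open>e\<close>; the total \<open>2 * \<eta> + e\<close> equals
      \<open>e * (2 * (2 * B + 2) + 1)\<close>. The minimum with 1 turns the bound
      \<open>2 * B + e\<close> for the difference of \<open>g\<close> and \<open>r\<close> into
      \<open>2 * B + 1\<close>.\<close>
    define e where "e = min 1 (\<epsilon> / (2 * (2 * B + 2) + 1))"
    define \<eta> where "\<eta> = e + (2 * B + 1) * e"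
    have e: "0 < e" "e \<le> 1" "2 * \<eta> + e \<le> \<epsilon>"
    proof -
      show "0 < e" "e \<le> 1"
        using \<open>0 < \<epsilon>\<close> \<open>0 \<le> B\<close> by (auto simp: e_def)
      have "e * (2 * (2 * B + 2) + 1) \<le> \<epsilon>"
        using \<open>0 \<le> B\<close> by (simp add: e_def min_le_iff_disj flip: pos_le_divide_eq)
      then show "2 * \<eta> + e \<le> \<epsilon>"
        by (simp add: \<eta>_def algebra_simps)
    qed
    obtain K1 where K1: "\<forall>\<^sub>F n in sequentially. prob {\<omega> \<in> space M. K1 < norm (Y n \<omega>)} < e"
      using char_convergence_tight[OF assms e(1)] by blast
    obtain K2 where K2: "N.prob {x \<in> space N. K2 < norm x} < e"
      using N.tight_random_vector[of "\<lambda>x. x" e] e(1) by auto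
    \<comment> \<open>The order of choices matters: \<open>r\<close> depends on the ball, so the
      radius is fixed by tightness before the approximation is made.\<close>
    define K where "K = max K1 K2"
    obtain r where r: "trig_polynomial r" "\<And>x. \<bar>r x\<bar> \<le> B + e"
        "\<And>x. norm x \<le> K \<Longrightarrow> \<bar>g x - r x\<bar> \<le> e"
      using trig_polynomial_approx[OF g(1) B e(1)] by metis
    have diff: "\<bar>g x - r x\<bar> \<le> 2 * B + 1" for x
      using B[of x] r(2)[of x] e(2) by linarith
    note int_r = integrable_trig_polynomial[OF r(1) Y]
      N.integrable_trig_polynomial[OF r(1) measurable_ident_sets[OF N(2)]]
    have "N.prob {x \<in> space N. K < norm x} \<le> N.prob {x \<in> space N. K2 < norm x}"
      by (rule N.finite_measure_mono) (auto simp: K_def)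
    with K2 have "(2 * B + 1) * N.prob {x \<in> space N. K < norm x} \<le> (2 * B + 1) * e"
      using \<open>0 \<le> B\<close> by (intro mult_left_mono) auto
    then have N_approx: "\<bar>N.expectation g - N.expectation r\<bar> \<le> \<eta>"
      using N.expectation_approx_outside_ball[where Z = "\<lambda>x. x" and K = K,
          OF measurable_ident_sets[OF N(2)] int_g(2) int_r(2) diff r(3)] e(1)
      unfolding \<eta>_def by linarith
    have "\<forall>\<^sub>F n in sequentially. dist (expectation (\<lambda>\<omega>. r (Y n \<omega>))) (N.expectation r) < e"
      using trig_polynomial_expectation_tendsto[OF Y N char r(1)] e(1) by (rule tendstoD)
    with K1 show "\<forall>\<^sub>F n in sequentially. dist (expectation (\<lambda>\<omega>. g (Y n \<omega>))) (N.expectation g) < \<epsilon>"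
    proof eventually_elim
      case (elim n)
      have "prob {\<omega> \<in> space M. K < norm (Y n \<omega>)} \<le> prob {\<omega> \<in> space M. K1 < norm (Y n \<omega>)}"
        by (rule finite_measure_mono) (auto simp: K_def)
      with elim have "(2 * B + 1) * prob {\<omega> \<in> space M. K < norm (Y n \<omega>)} \<le> (2 * B + 1) * e"
        using \<open>0 \<le> B\<close> by (intro mult_left_mono) auto
      then have "\<bar>expectation (\<lambda>\<omega>. g (Y n \<omega>)) - expectation (\<lambda>\<omega>. r (Y n \<omega>))\<bar> \<le> \<eta>"
        using expectation_approx_outside_ball[where Z = "Y n" and K = K, OF Y int_g(1) int_r(1) diff r(3)] e(1)
        unfolding \<eta>_def by linarith
      then have "dist (expectation (\<lambda>\<omega>. g (Y n \<omega>))) (expectation (\<lambda>\<omega>. r (Y n \<omega>))) \<le> \<eta>"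
        by (simp only: dist_real_def)
      moreover have "dist (N.expectation r) (N.expectation g) \<le> \<eta>"
        using N_approx by (simp only: dist_real_def abs_minus_commute)
      moreover have "dist u z \<le> dist u v + (dist v w + dist w z)" for u v w z :: real
        using dist_triangle[of u z v] dist_triangle[of v z w] by linarith
      note this[of _ "N.expectation g" "expectation (\<lambda>\<omega>. r (Y n \<omega>))" "N.expectation r"]
      ultimately show ?case
        using elim(2) e(3) by (smt (verit, best))
    qed
  qed
qed fact

text \<open>The easy converse, needed to start from a known limit law. Test functions are real, so
  the character is split into cosine and sine.\<close>

lemma (in prob_space) char_convergence:
  fixes Y :: "nat \<Rightarrow> 'a \<Rightarrow> 'b::euclidean_space"
  assumes conv: "converges_in_distribution M Y N"
    and N: "prob_space N" "sets N = sets borel"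
  shows "(\<lambda>n. CLINT \<omega>|M. iexp (t \<bullet> Y n \<omega>)) \<longlonglongrightarrow> (CLINT y|N. iexp (t \<bullet> y))"
proof -
  interpret N: prob_space N by fact
  note [measurable_cong] = N(2)
  have [measurable]: "Y n \<in> borel_measurable M" for n
    using conv by (simp add: converges_in_distribution_def)
  have int: "integrable M (\<lambda>\<omega>. iexp (t \<bullet> Y n \<omega>))" "integrable N (\<lambda>y. iexp (t \<bullet> y))" for n
    by (auto intro!: integrable_const_bound[of _ 1] N.integrable_const_bound[of _ 1])
  have "(\<lambda>n. expectation (\<lambda>\<omega>. h (t \<bullet> Y n \<omega>))) \<longlonglongrightarrow> (\<integral>y. h (t \<bullet> y) \<partial>N)"
    if "continuous_on UNIV h" "\<And>x. \<bar>h x\<bar> \<le> 1" for h :: "real \<Rightarrow> real"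
  proof -
    have "continuous_on UNIV (\<lambda>x. h (t \<bullet> x))"
      by (intro continuous_on_compose2[OF that(1)] continuous_intros) auto
    moreover have "bounded (range (\<lambda>x. h (t \<bullet> x)))"
      using that(2) by (auto intro!: boundedI[of _ 1])
    ultimately show ?thesis
      using conv unfolding converges_in_distribution_def by blast
  qed
  note this[of cos] this[of sin]
  moreover have "continuous_on UNIV (cos :: real \<Rightarrow> real)" "continuous_on UNIV (sin :: real \<Rightarrow> real)"
    by (intro continuous_intros)+
  ultimately show ?thesis
    using int by (auto simp: tendsto_complex_iff Re_exp Im_exp simp flip: integral_Re integral_Im)
qed

text \<open>The difference between the rescaled increment of \<open>h\<close> and its linearization tends to \<open>0\<close> in
  probability, and characters are bounded and Lipschitz.\<close>

theorem (in prob_space) delta_method: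
  fixes V :: "nat \<Rightarrow> 'a \<Rightarrow> 'b::euclidean_space" and h :: "'b \<Rightarrow> 'c::euclidean_space"
  assumes conv: "converges_in_distribution M V N"
    and N: "prob_space N" "sets N = sets borel"
    and [measurable]: "h \<in> borel_measurable borel"
    and deriv: "(h has_derivative h') (at m)"
    and a: "filterlim a at_top sequentially"
  shows "converges_in_distribution M (\<lambda>n \<omega>. a n *\<^sub>R (h (m + V n \<omega> /\<^sub>R a n) - h m)) (distr N borel h')"
proof (rule levy_continuity_euclidean)
  interpret N: prob_space N by fact
  note [measurable_cong] = N(2)
  have lin: "bounded_linear h'"
    using deriv by (rule has_derivative_bounded_linear)
  have [measurable]: "h' \<in> borel_measurable borel"
    using lin by (intro borel_measurable_continuous_onI linear_continuous_on)
  have [measurable]: "V n \<in> borel_measurable M" for n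
    using conv by (simp add: converges_in_distribution_def)
  show "prob_space (distr N borel h')"
    by (intro N.prob_space_distr) simp
  show "(\<lambda>\<omega>. a n *\<^sub>R (h (m + V n \<omega> /\<^sub>R a n) - h m)) \<in> borel_measurable M" for n
    by measurable
  fix t :: 'c
  define W where "W n \<omega> = a n *\<^sub>R (h (m + V n \<omega> /\<^sub>R a n) - h m)" for n \<omega>
  have [measurable]: "W n \<in> borel_measurable M" for n
    unfolding W_def by measurable
  have adj: "t \<bullet> h' x = adjoint h' t \<bullet> x" for x
    using adjoint_works[of h' x t] lin by (simp add: inner_commute bounded_linear.linear)
  have "(\<lambda>n. CLINT \<omega>|M. iexp (t \<bullet> h' (V n \<omega>))) \<longlonglongrightarrow> (CLINT y|distr N borel h'. iexp (t \<bullet> y))"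
    using char_convergence[OF conv N, of "adjoint h' t"] by (simp add: integral_distr adj)
  moreover have "(\<lambda>n. (CLINT \<omega>|M. iexp (t \<bullet> W n \<omega>)) - (CLINT \<omega>|M. iexp (t \<bullet> h' (V n \<omega>)))) \<longlonglongrightarrow> 0"
  proof (rule tendstoI)
    fix \<epsilon> :: real assume "0 < \<epsilon>"
    then obtain K' where K': "\<forall>\<^sub>F n in sequentially. prob {\<omega> \<in> space M. K' < norm (V n \<omega>)} < \<epsilon> / 4"
      using converges_in_distribution_tight[OF conv N, of "\<epsilon> / 4"] by auto
    define K where "K = max K' 1"
    \<comment> \<open>Makes the Lipschitz bound \<open>norm t * (e * K)\<close> at most a quarter of
      \<open>\<epsilon>\<close>. The summand 1 keeps the denominator positive for
      \<open>t = 0\<close>, just as the maximum with 1 does for \<open>K\<close>.\<close>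
    define e where "e = \<epsilon> / (4 * (norm t + 1) * K)"
    have "0 < K" and "0 < e"
      using \<open>0 < \<epsilon>\<close> by (auto simp: K_def e_def add_nonneg_pos)
    have e: "norm t * (e * K) \<le> \<epsilon> / 4"
    proof -
      have "(norm t + 1) * (e * K) = \<epsilon> / 4"
        using \<open>0 < K\<close> by (simp add: e_def divide_simps add_nonneg_eq_0_iff)
      moreover have "norm t * (e * K) \<le> (norm t + 1) * (e * K)"
        using \<open>0 < e\<close> \<open>0 < K\<close> by (intro mult_right_mono) auto
      ultimately show ?thesis by simp
    qed
    obtain d where d: "0 < d" "\<And>y. norm (y - m) < d \<Longrightarrow> norm (h y - h m - h' (y - m)) \<le> e * norm (y - m)"
      using deriv \<open>0 < e\<close> unfolding has_derivative_at_alt by blast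
    \<comment> \<open>From such an \<open>n\<close> on, every value of \<open>V n\<close> in the
      ball of radius \<open>K\<close> is shrunk by \<open>a n\<close> into the radius
      \<open>d\<close> on which the derivative estimate holds.\<close>
    have "\<forall>\<^sub>F n in sequentially. max 1 (K / d + 1) \<le> a n"
      using a unfolding filterlim_at_top by blast
    with K' show "\<forall>\<^sub>F n in sequentially.
        dist ((CLINT \<omega>|M. iexp (t \<bullet> W n \<omega>)) - (CLINT \<omega>|M. iexp (t \<bullet> h' (V n \<omega>)))) 0 < \<epsilon>"
    proof eventually_elim
      case (elim n)
      then have "0 < a n" "K / d < a n"
        by auto
      then have an: "0 < a n" "K < d * a n"
        using d(1) by (auto simp: pos_divide_less_eq mult.commute)
      let ?A = "{\<omega> \<in> space M. K < norm (V n \<omega>)}"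
      have close: "norm (W n \<omega> - h' (V n \<omega>)) \<le> e * K" if "norm (V n \<omega>) \<le> K" for \<omega>
      proof -
        have "norm (V n \<omega> /\<^sub>R a n) < d"
          using an that by (simp add: field_simps)
        then have "norm (h (m + V n \<omega> /\<^sub>R a n) - h m - h' (V n \<omega> /\<^sub>R a n)) \<le> e * norm (V n \<omega> /\<^sub>R a n)"
          using d(2)[of "m + V n \<omega> /\<^sub>R a n"] by simp
        then have "a n * norm (h (m + V n \<omega> /\<^sub>R a n) - h m - h' (V n \<omega> /\<^sub>R a n)) \<le> e * norm (V n \<omega>)"
          using an by (simp add: field_simps)
        moreover have "W n \<omega> - h' (V n \<omega>) = a n *\<^sub>R (h (m + V n \<omega> /\<^sub>R a n) - h m - h' (V n \<omega> /\<^sub>R a n))"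
          using an lin by (simp add: W_def scaleR_diff_right linear_simps)
        moreover have "e * norm (V n \<omega>) \<le> e * K"
          using that \<open>0 < e\<close> by simp
        ultimately show ?thesis
          using an by simp
      qed
      \<comment> \<open>Off \<open>?A\<close> the derivative estimate applies; on \<open>?A\<close>
        two numbers of modulus 1 differ by at most 2. As \<open>?A\<close> has probability below
        \<open>\<epsilon> / 4\<close>, the integrated bound is below three quarters of
        \<open>\<epsilon>\<close>.\<close>
      have pointwise: "cmod (iexp (t \<bullet> W n \<omega>) - iexp (t \<bullet> h' (V n \<omega>))) \<le> \<epsilon> / 4 + 2 * indicator ?A \<omega>"
        if "\<omega> \<in> space M" for \<omega>
      proof (cases "\<omega> \<in> ?A")
        case True
        then show ?thesis
          using norm_triangle_ineq4[of "iexp (t \<bullet> W n \<omega>)" "iexp (t \<bullet> h' (V n \<omega>))"] \<open>0 < \<epsilon>\<close> by simp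
      next
        case False
        let ?x = "t \<bullet> W n \<omega>" and ?y = "t \<bullet> h' (V n \<omega>)"
        have "iexp ?x - iexp ?y = iexp ?y * (iexp (?x - ?y) - 1)"
          by (simp add: algebra_simps flip: exp_add)
        then have "cmod (iexp ?x - iexp ?y) = cmod (iexp (?x - ?y) - 1)"
          by (simp add: norm_mult del: of_real_diff)
        also have "\<dots> \<le> \<bar>?x - ?y\<bar>"
          using iexp_approx1[of "?x - ?y" 0] by (simp del: of_real_diff)
        also have "\<dots> \<le> norm t * norm (W n \<omega> - h' (V n \<omega>))"
          by (metis Cauchy_Schwarz_ineq2 inner_diff_right)
        also have "\<dots> \<le> norm t * (e * K)"
          using False that close by (intro mult_left_mono) auto
        finally show ?thesis
          using False e by simp
      qed
      have int: "integrable M (\<lambda>\<omega>. iexp (t \<bullet> W n \<omega>))" "integrable M (\<lambda>\<omega>. iexp (t \<bullet> h' (V n \<omega>)))"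
        "integrable M (indicator ?A :: 'a \<Rightarrow> real)"
        by (auto intro!: integrable_const_bound[of _ 1])
      have "cmod ((CLINT \<omega>|M. iexp (t \<bullet> W n \<omega>)) - (CLINT \<omega>|M. iexp (t \<bullet> h' (V n \<omega>))))
          = cmod (CLINT \<omega>|M. iexp (t \<bullet> W n \<omega>) - iexp (t \<bullet> h' (V n \<omega>)))"
        using int by simp
      also have "\<dots> \<le> expectation (\<lambda>\<omega>. cmod (iexp (t \<bullet> W n \<omega>) - iexp (t \<bullet> h' (V n \<omega>))))"
        by (rule integral_norm_bound)
      also have "\<dots> \<le> expectation (\<lambda>\<omega>. \<epsilon> / 4 + 2 * indicator ?A \<omega>)"
        using int pointwise by (intro integral_mono) auto
      also have "\<dots> = \<epsilon> / 4 + 2 * prob ?A"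
        using int by (simp add: prob_space)
      also have "prob ?A \<le> prob {\<omega> \<in> space M. K' < norm (V n \<omega>)}"
        by (rule finite_measure_mono) (auto simp: K_def)
      finally show ?case
        using elim(1) \<open>0 < \<epsilon>\<close> by (simp add: dist_norm)
    qed
  qed
  ultimately show "(\<lambda>n. CLINT \<omega>|M. iexp (t \<bullet> a n *\<^sub>R (h (m + V n \<omega> /\<^sub>R a n) - h m)))
      \<longlonglongrightarrow> (CLINT y|distr N borel h'. iexp (t \<bullet> y))"
    unfolding W_def by (rule Lim_transform)
qed simp

section \<open>Central limit theorem\<close>

lemma (in prob_space) central_limit_char:
  fixes X :: "nat \<Rightarrow> 'a \<Rightarrow> real"
  assumes indep: "indep_vars (\<lambda>_. borel) X UNIV"
    and mean: "\<And>n. expectation (X n) = 0"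
    and sq_int: "\<And>n. integrable M (\<lambda>\<omega>. (X n \<omega>)\<^sup>2)"
    and distr: "\<And>n. distr M borel (X n) = \<mu>"
  shows "(\<lambda>n. CLINT \<omega>|M. iexp ((\<Sum>i<n. X i \<omega>) / sqrt n))
    \<longlonglongrightarrow> of_real (exp (- expectation (\<lambda>\<omega>. (X 0 \<omega>)\<^sup>2) / 2))"
proof -
  define v where "v = expectation (\<lambda>\<omega>. (X 0 \<omega>)\<^sup>2)"
  have [measurable]: "X n \<in> borel_measurable M" for n
    using indep unfolding indep_vars_def2 by simp
  have v: "expectation (\<lambda>\<omega>. (X n \<omega>)\<^sup>2) = v" for n
  proof -
    have "expectation (\<lambda>\<omega>. (X n \<omega>)\<^sup>2) = (\<integral>x. x\<^sup>2 \<partial>\<mu>)" for n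
      by (simp add: integral_distr flip: distr[of n])
    then show ?thesis by (simp add: v_def)
  qed
  have "0 \<le> v"
    by (simp add: v_def)
  show ?thesis
  proof (cases "v = 0")
    \<comment> \<open>The library theorem normalises by a positive standard deviation. Without
      variance all summands vanish almost surely, and both sides are 1.\<close>
    case True
    have "AE \<omega> in M. X i \<omega> = 0" for i
      using integral_nonneg_eq_0_iff_AE[OF sq_int[of i]] v[of i] True by simp
    then have "AE \<omega> in M. \<forall>i. X i \<omega> = 0"
      by (simp add: AE_all_countable)
    then have "(CLINT \<omega>|M. iexp ((\<Sum>i<n. X i \<omega>) / sqrt n)) = (CLINT \<omega>|M. 1)" for n
      by (intro integral_cong_AE) auto
    then show ?thesis
      using True by (simp add: v_def[symmetric] prob_space)
  next
    case False
    define \<sigma> where "\<sigma> = sqrt v"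
    have \<sigma>: "0 < \<sigma>" "\<sigma>\<^sup>2 = v"
      using False \<open>0 \<le> v\<close> by (simp_all add: \<sigma>_def)
    \<comment> \<open>Evaluating the character of the normalised sum at \<open>\<sigma>\<close>
      undoes the division by \<open>\<sigma>\<close> and turns the standard normal limit into
      \<open>exp (- v / 2)\<close>.\<close>
    let ?D = "\<lambda>n. distr M borel (\<lambda>\<omega>. (\<Sum>i<n. X i \<omega>) / sqrt (n * \<sigma>\<^sup>2))"
    have "weak_conv_m ?D std_normal_distribution"
      using indep mean \<sigma>(1) sq_int _ distr
      by (rule central_limit_theorem_zero_mean) (simp add: mean v \<sigma>(2))
    then have "(\<lambda>n. char (?D n) \<sigma>) \<longlonglongrightarrow> char std_normal_distribution \<sigma>"
      by (intro levy_continuity1 real_dist_normal_dist) auto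
    moreover have "char (?D n) \<sigma> = (CLINT \<omega>|M. iexp ((\<Sum>i<n. X i \<omega>) / sqrt n))" for n
    proof -
      have "\<sigma> * (s / sqrt (n * \<sigma>\<^sup>2)) = s / sqrt n" for s
        using \<sigma>(1) by (simp add: real_sqrt_mult)
      then show ?thesis
        by (simp add: char_def integral_distr del: of_real_divide of_real_mult)
    qed
    ultimately show ?thesis
      by (simp add: char_std_normal_distribution v_def[symmetric] \<sigma>(2))
  qed
qed

section \<open>Square-integrable random vectors and the multivariate limit theorem\<close>

lemma borel_measurable_vec_nth [measurable]: "(\<lambda>x :: real^'n. x $ i) \<in> borel_measurable borel"
  by (intro borel_measurable_continuous_onI continuous_intros)

lemma integrable_mult_components:
  fixes Y :: "'a \<Rightarrow> real^'n"
  assumes [measurable]: "Y \<in> borel_measurable M" and int: "integrable M (\<lambda>\<omega>. (norm (Y \<omega>))\<^sup>2)"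
  shows "integrable M (\<lambda>\<omega>. Y \<omega> $ i * Y \<omega> $ j)"
proof (rule Bochner_Integration.integrable_bound[OF int])
  have "\<bar>Y \<omega> $ i\<bar> * \<bar>Y \<omega> $ j\<bar> \<le> norm (Y \<omega>) * norm (Y \<omega>)" for \<omega>
    by (intro mult_mono component_le_norm_cart) auto
  then show "AE \<omega> in M. norm (Y \<omega> $ i * Y \<omega> $ j) \<le> norm ((norm (Y \<omega>))\<^sup>2)"
    by (simp add: abs_mult power2_eq_square)
qed measurable

lemma (in prob_space) integrable_centered_square:
  fixes Y :: "'a \<Rightarrow> 'b::euclidean_space"
  assumes [measurable]: "Y \<in> borel_measurable M" and int: "integrable M (\<lambda>\<omega>. (norm (Y \<omega>))\<^sup>2)"
  shows "integrable M (\<lambda>\<omega>. (norm (Y \<omega> - m))\<^sup>2)"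
proof (rule Bochner_Integration.integrable_bound)
  show "integrable M (\<lambda>\<omega>. 2 * (norm (Y \<omega>))\<^sup>2 + 2 * (norm m)\<^sup>2)"
    using int by simp
  have "(norm (Y \<omega> - m))\<^sup>2 \<le> 2 * (norm (Y \<omega>))\<^sup>2 + 2 * (norm m)\<^sup>2" for \<omega>
  proof -
    have "(norm (Y \<omega> - m))\<^sup>2 \<le> (norm (Y \<omega>) + norm m)\<^sup>2"
      by (intro power_mono norm_triangle_ineq4) simp
    also have "\<dots> \<le> 2 * (norm (Y \<omega>))\<^sup>2 + 2 * (norm m)\<^sup>2"
      using sum_squares_bound[of "norm (Y \<omega>)" "norm m"] by (simp add: power2_sum)
    finally show ?thesis .
  qed
  then show "AE \<omega> in M. norm ((norm (Y \<omega> - m))\<^sup>2) \<le> norm (2 * (norm (Y \<omega>))\<^sup>2 + 2 * (norm m)\<^sup>2)"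
    by simp
qed measurable

lemma (in prob_space) integrable_of_norm_square:
  fixes Y :: "'a \<Rightarrow> 'b::euclidean_space"
  assumes [measurable]: "Y \<in> borel_measurable M" and "integrable M (\<lambda>\<omega>. (norm (Y \<omega>))\<^sup>2)"
  shows "integrable M Y"
proof -
  have "integrable M (\<lambda>\<omega>. norm (Y \<omega>))"
    using assms(2) by (rule square_integrable_imp_integrable[rotated]) measurable
  then show ?thesis
    by (simp add: integrable_norm_iff)
qed

text \<open>Used twice: it identifies the variance of a scalar projection in the limit theorem, and
  it shows that a covariance matrix is positive semidefinite.\<close>

lemma (in prob_space) covariance_matrix_quadratic_form:
  fixes Y :: "'a \<Rightarrow> real^'n"
  assumes [measurable]: "Y \<in> borel_measurable M" and int: "integrable M (\<lambda>\<omega>. (norm (Y \<omega>))\<^sup>2)"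
  shows "t \<bullet> (covariance_matrix M Y *v t) = expectation (\<lambda>\<omega>. (t \<bullet> (Y \<omega> - expectation Y))\<^sup>2)"
proof -
  let ?Z = "\<lambda>\<omega>. Y \<omega> - expectation Y"
  have mean: "expectation (\<lambda>\<omega>. Y \<omega> $ i) = expectation Y $ i" for i
    using integral_bounded_linear[OF bounded_linear_vec_nth integrable_of_norm_square[OF assms]] .
  have int_Z: "integrable M (\<lambda>\<omega>. ?Z \<omega> $ i * ?Z \<omega> $ j)" for i j
    by (intro integrable_mult_components integrable_centered_square int) measurable
  have "expectation (\<lambda>\<omega>. (t \<bullet> ?Z \<omega>)\<^sup>2)
      = expectation (\<lambda>\<omega>. \<Sum>i\<in>UNIV. \<Sum>j\<in>UNIV. t $ i * t $ j * (?Z \<omega> $ i * ?Z \<omega> $ j))"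
    by (simp add: inner_vec_def power2_eq_square sum_product algebra_simps)
  also have "\<dots> = (\<Sum>i\<in>UNIV. \<Sum>j\<in>UNIV. t $ i * t $ j * expectation (\<lambda>\<omega>. ?Z \<omega> $ i * ?Z \<omega> $ j))"
    using int_Z by simp
  also have "\<dots> = (\<Sum>i\<in>UNIV. \<Sum>j\<in>UNIV. t $ i * (covariance_matrix M Y $ i $ j * t $ j))"
    by (simp add: covariance_matrix_def mean mult.assoc mult.commute[of "t $ _" "expectation _"])
  also have "\<dots> = t \<bullet> (covariance_matrix M Y *v t)"
    by (simp add: inner_vec_def matrix_vector_mult_def sum_distrib_left)
  finally show ?thesis ..
qed

lemma sets_multivariate_normal [simp]: "sets (multivariate_normal m S) = sets borel"
  unfolding multivariate_normal_def Let_def by (rule sets_distr)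

lemma prob_space_multivariate_normal:
  fixes S :: "real^'n^'n"
  shows "prob_space (multivariate_normal m S)"
  unfolding multivariate_normal_def Let_def
proof (rule prob_space.prob_space_distr)
  show "prob_space (\<Pi>\<^sub>M i\<in>(UNIV :: 'n set). std_normal_distribution)"
    by (intro prob_space_PiM prob_space_normal_density) simp
qed (rule measurable_normal_vector)

text \<open>The Cramer-Wold device: the character of the vector sum at \<open>t\<close> is that of
  the scalar sum of the projections at 1, to which \<open>central_limit_char\<close> applies. The
  root \<open>A\<close> guarantees that the choice inside \<open>multivariate_normal\<close> is a
  genuine root.\<close>

theorem (in prob_space) multivariate_central_limit_theorem:
  fixes Y :: "nat \<Rightarrow> 'a \<Rightarrow> real^'n" and A :: "real^'n^'n"
  assumes indep: "indep_vars (\<lambda>_. borel) Y UNIV"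
    and distr: "\<And>n. distr M borel (Y n) = distr M borel (Y 0)"
    and int: "integrable M (\<lambda>\<omega>. (norm (Y 0 \<omega>))\<^sup>2)"
    and root: "A ** transpose A = covariance_matrix M (Y 0)"
  shows "converges_in_distribution M
    (\<lambda>n \<omega>. (\<Sum>i<n. Y i \<omega> - expectation (Y 0)) /\<^sub>R sqrt n)
    (multivariate_normal 0 (covariance_matrix M (Y 0)))"
proof (rule levy_continuity_euclidean[OF _ prob_space_multivariate_normal sets_multivariate_normal])
  have [measurable]: "Y n \<in> borel_measurable M" for n
    using indep unfolding indep_vars_def2 by simp
  show "(\<lambda>\<omega>. (\<Sum>i<n. Y i \<omega> - expectation (Y 0)) /\<^sub>R sqrt n) \<in> borel_measurable M" for n
    by measurable
  fix t :: "real^'n"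
  define h where "h y = t \<bullet> (y - expectation (Y 0))" for y
  have [measurable]: "h \<in> borel_measurable borel"
    unfolding h_def by measurable
  have distr_h: "distr M borel (\<lambda>\<omega>. h (Y n \<omega>)) = distr M borel (\<lambda>\<omega>. h (Y 0 \<omega>))" for n
  proof -
    have "distr M borel (\<lambda>\<omega>. h (Y n \<omega>)) = distr (distr M borel (Y n)) borel h" for n
      by (simp add: distr_distr comp_def)
    then show ?thesis
      by (simp only: distr[of n])
  qed
  \<comment> \<open>Moments are given for \<open>Y 0\<close> only; written as integrals against the
    common law, they pass to every \<open>Y n\<close>.\<close>
  have transfer: "integrable M (\<lambda>\<omega>. (h (Y n \<omega>))\<^sup>2) = integrable (distr M borel (\<lambda>\<omega>. h (Y n \<omega>))) (\<lambda>x. x\<^sup>2)"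
    "expectation (\<lambda>\<omega>. h (Y n \<omega>)) = integral\<^sup>L (distr M borel (\<lambda>\<omega>. h (Y n \<omega>))) (\<lambda>x. x)" for n
    by (simp_all add: integrable_distr_eq integral_distr)
  have "integrable M (\<lambda>\<omega>. (h (Y 0 \<omega>))\<^sup>2)"
  proof (rule Bochner_Integration.integrable_bound)
    show "integrable M (\<lambda>\<omega>. (norm t)\<^sup>2 * (norm (Y 0 \<omega> - expectation (Y 0)))\<^sup>2)"
      using int by (intro integrable_mult_right integrable_centered_square) auto
    have "(h y)\<^sup>2 \<le> (norm t)\<^sup>2 * (norm (y - expectation (Y 0)))\<^sup>2" for y
      using power_mono[OF Cauchy_Schwarz_ineq2[of t "y - expectation (Y 0)"], of 2]
      by (simp add: h_def power_mult_distrib)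
    then show "AE \<omega> in M. norm ((h (Y 0 \<omega>))\<^sup>2)
        \<le> norm ((norm t)\<^sup>2 * (norm (Y 0 \<omega> - expectation (Y 0)))\<^sup>2)"
      by simp
  qed measurable
  then have sq_int: "integrable M (\<lambda>\<omega>. (h (Y n \<omega>))\<^sup>2)" for n
    unfolding transfer distr_h[of n] .
  have "expectation (\<lambda>\<omega>. h (Y 0 \<omega>)) = 0"
    using integrable_of_norm_square[OF _ int] by (simp add: h_def prob_space)
  then have mean: "expectation (\<lambda>\<omega>. h (Y n \<omega>)) = 0" for n
    unfolding transfer distr_h[of n] .
  have "indep_vars (\<lambda>_. borel) (\<lambda>n \<omega>. h (Y n \<omega>)) UNIV"
    using indep by (rule indep_vars_compose2) simp
  from central_limit_char[OF this mean sq_int distr_h]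
  have "(\<lambda>n. CLINT \<omega>|M. iexp ((\<Sum>i<n. h (Y i \<omega>)) / sqrt n))
      \<longlonglongrightarrow> of_real (exp (- (t \<bullet> (covariance_matrix M (Y 0) *v t)) / 2))"
    using int by (simp add: covariance_matrix_quadratic_form h_def)
  also have "(\<lambda>n. CLINT \<omega>|M. iexp ((\<Sum>i<n. h (Y i \<omega>)) / sqrt n))
      = (\<lambda>n. CLINT \<omega>|M. iexp (t \<bullet> ((\<Sum>i<n. Y i \<omega> - expectation (Y 0)) /\<^sub>R sqrt n)))"
    by (simp add: h_def inner_sum_right divide_inverse mult.commute)
  also have "of_real (exp (- (t \<bullet> (covariance_matrix M (Y 0) *v t)) / 2))
      = (CLINT y|multivariate_normal 0 (covariance_matrix M (Y 0)). iexp (t \<bullet> y))"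
    by (subst char_multivariate_normal[OF root]) (simp flip: exp_of_real)
  finally show "(\<lambda>n. CLINT \<omega>|M. iexp (t \<bullet> ((\<Sum>i<n. Y i \<omega> - expectation (Y 0)) /\<^sub>R sqrt n)))
      \<longlonglongrightarrow> (CLINT y|multivariate_normal 0 (covariance_matrix M (Y 0)). iexp (t \<bullet> y))" .
qed

text \<open>The lower triangular Cholesky factor, written out. A zero upper left entry would be
  divided by, so it is a separate case.\<close>

lemma psd_matrix_root_2:
  fixes S :: "real^2^2"
  assumes sym: "S $ 1 $ 2 = S $ 2 $ 1" and psd: "\<And>t. 0 \<le> t \<bullet> (S *v t)"
  shows "\<exists>A :: real^2^2. A ** transpose A = S"
proof -
  let ?a = "S $ 1 $ 1" and ?b = "S $ 2 $ 1" and ?c = "S $ 2 $ 2"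
  have quad: "0 \<le> x * (?a * x + ?b * y) + y * (?b * x + ?c * y)" for x y
    using psd[of "vector [x, y]"] sym by (simp add: inner_vec_def matrix_vector_mult_def sum_2)
  have "0 \<le> ?a" "0 \<le> ?c"
    using quad[of 1 0] quad[of 0 1] by auto
  show ?thesis
  proof (cases "?a = 0")
    case True
    have "?b = 0"
    proof (rule ccontr)
      assume "?b \<noteq> 0"
      \<comment> \<open>With \<open>?a = 0\<close> the form at \<open>(x, 1)\<close> is
        \<open>2 * ?b * x + ?c\<close>; this \<open>x\<close> makes it \<open>- ?c - 2\<close>,
        which is negative.\<close>
      define x where "x = - (?c + 1) / ?b"
      have "?b * x = - (?c + 1)"
        using \<open>?b \<noteq> 0\<close> by (simp add: x_def)
      then show False
        using quad[of x 1] True \<open>0 \<le> ?c\<close> by (simp add: mult.commute)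
    qed
    let ?A = "vector [vector [0, 0], vector [0, sqrt ?c]] :: real^2^2"
    have "?A ** transpose ?A = S"
      using True \<open>?b = 0\<close> \<open>0 \<le> ?c\<close> sym
      by (simp add: vec_eq_iff forall_2 matrix_matrix_mult_def transpose_def sum_2)
    then show ?thesis by (rule exI)
  next
    case False
    with \<open>0 \<le> ?a\<close> have "0 < ?a" by simp
    \<comment> \<open>At \<open>(- ?b, ?a)\<close> the form equals \<open>?a\<close> times the
      determinant.\<close>
    have "0 \<le> ?a * (?a * ?c - ?b * ?b)"
      using quad[of "- ?b" ?a] by (simp add: algebra_simps)
    then have det: "0 \<le> ?c - ?b * ?b / ?a"
      using \<open>0 < ?a\<close> by (simp add: field_simps zero_le_mult_iff)
    let ?A = "vector [vector [sqrt ?a, 0], vector [?b / sqrt ?a, sqrt (?c - ?b * ?b / ?a)]] :: real^2^2"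
    have "?A ** transpose ?A = S"
      using \<open>0 < ?a\<close> det sym
      by (simp add: vec_eq_iff forall_2 matrix_matrix_mult_def transpose_def sum_2)
    then show ?thesis by (rule exI)
  qed
qed

section \<open>Inverses of injective holomorphic functions\<close>

lemma bounded_linear_vec_of_complex: "bounded_linear vec_of_complex"
  unfolding linear_conv_bounded_linear[symmetric]
  by (rule linearI) (simp_all add: vec_of_complex_def vec_eq_iff forall_2)

lemma bounded_linear_complex_of_vec: "bounded_linear complex_of_vec"
  unfolding linear_conv_bounded_linear[symmetric]
  by (rule linearI) (simp_all add: complex_of_vec_def complex_eq_iff)

lemma norm_vec_of_complex [simp]: "norm (vec_of_complex z) = cmod z"
  by (simp add: vec_of_complex_def norm_vec_def L2_set_def sum_2 cmod_def)

lemma inv_into_holomorphic_on: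
  assumes "f holomorphic_on U" "open U" "inj_on f U"
  shows "inv_into U f holomorphic_on f ` U"
proof -
  obtain g where g: "g holomorphic_on f ` U" "\<And>z. z \<in> U \<Longrightarrow> g (f z) = z"
    using holomorphic_has_inverse[OF assms] by metis
  show ?thesis
    by (rule holomorphic_transform[OF g(1)]) (use g(2) assms(3) in auto)
qed

text \<open>Off the image, \<^const>\<open>inv_into\<close> returns one fixed junk value.\<close>

lemma inv_into_borel_measurable:
  assumes "f holomorphic_on U" "open U" "inj_on f U"
  shows "inv_into U f \<in> borel_measurable borel"
proof -
  have "(\<lambda>y. if y \<in> f ` U then inv_into U f y else (SOME x. False)) \<in> borel_measurable borel"
    using assms inv_into_holomorphic_on[OF assms] open_mapping_thm3[OF assms]
    by (intro borel_measurable_continuous_on_if holomorphic_on_imp_continuous_on continuous_on_const) auto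
  also have "(\<lambda>y. if y \<in> f ` U then inv_into U f y else (SOME x. False)) = inv_into U f"
  proof
    fix y show "(if y \<in> f ` U then inv_into U f y else (SOME x. False)) = inv_into U f y"
    proof (cases "y \<in> f ` U")
      case False
      then have "(\<lambda>x. x \<in> U \<and> f x = y) = (\<lambda>x. False)"
        by auto
      with False show ?thesis
        by (simp add: inv_into_def)
    qed simp
  qed
  finally show ?thesis .
qed

section \<open>Asymptotic normality of the inverse image of the sample mean\<close>

theorem theorem1p5:
  fixes \<alpha> :: complex and U :: "complex set" and f :: "complex \<Rightarrow> complex"
    and M :: "'a measure" and X :: "nat \<Rightarrow> 'a \<Rightarrow> real"
  assumes "Im \<alpha> \<le> 0"
    and "open U" and "connected U" and "simply_connected U"
    and "{z. 0 \<le> Im z} - {\<alpha>} \<subseteq> U"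
    and "f holomorphic_on U" and "inj_on f U"
    and "convex (f ` ({z. 0 \<le> Im z} - {\<alpha>}))"
    and "prob_space M"
    and "prob_space.indep_vars M (\<lambda>_. borel) X {1..}"
    and "\<And>i. i \<ge> 1 \<Longrightarrow> distr M borel (X i) = distr M borel (X 1)"
    and "\<And>i x. i \<ge> 1 \<Longrightarrow> measure M {\<omega> \<in> space M. X i \<omega> = x} = 0"
    and "integrable M (\<lambda>\<omega>. (cmod (f (complex_of_real (X 1 \<omega>))))\<^sup>2)"
  shows "converges_in_distribution M
    (\<lambda>n \<omega>. sqrt (real n) *\<^sub>R
       (vec_of_complex (inv_into U f ((\<Sum>j=1..n. f (complex_of_real (X j \<omega>))) / of_nat n))
        - vec_of_complex (inv_into U f (\<integral>\<omega>'. f (complex_of_real (X 1 \<omega>')) \<partial>M))))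
    (let J = jacobian (\<lambda>v. vec_of_complex (inv_into U f (complex_of_vec v)))
               (at (vec_of_complex (\<integral>\<omega>. f (complex_of_real (X 1 \<omega>)) \<partial>M)))
     in multivariate_normal 0
          (J ** covariance_matrix M (\<lambda>\<omega>. vec_of_complex (f (complex_of_real (X 1 \<omega>)))) ** transpose J))"
proof -
  interpret prob_space M by fact
  note inverse = inv_into_holomorphic_on[OF assms(6,2,7)] inv_into_borel_measurable[OF assms(6,2,7)]
  have [measurable]: "inv_into U f \<in> borel_measurable borel"
    by (rule inverse(2))
  have X: "X i \<in> borel_measurable M" if "1 \<le> i" for i
    using assms(10) that unfolding indep_vars_def2 by simp
  have [measurable]: "X 1 \<in> borel_measurable M" "X (Suc i) \<in> borel_measurable M" for i
    by (auto intro!: X)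
  have real_in_half_plane: "complex_of_real x \<in> {z. 0 \<le> Im z} - {\<alpha>}" if "x \<noteq> Re \<alpha>" for x
    using that by auto
  \<comment> \<open>If \<open>\<alpha>\<close> is real, \<open>U\<close> may miss it and
    \<open>f\<close> is arbitrary there. One exceptional point does not affect Borel
    measurability.\<close>
  have [measurable]: "(\<lambda>x. f (complex_of_real x)) \<in> borel_measurable borel"
  proof (rule borel_measurable_continuous_countable_exceptions)
    show "continuous_on (- {Re \<alpha>}) (\<lambda>x. f (complex_of_real x))"
    proof (rule continuous_on_compose2[OF holomorphic_on_imp_continuous_on[OF assms(6)]])
      show "complex_of_real ` (- {Re \<alpha>}) \<subseteq> U"
        using real_in_half_plane assms(5) by blast
    qed (intro continuous_intros)
  qed simp
  have [measurable]: "vec_of_complex \<in> borel_measurable borel" "complex_of_vec \<in> borel_measurable borel"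
    by (intro borel_measurable_continuous_onI linear_continuous_on
        bounded_linear_vec_of_complex bounded_linear_complex_of_vec)+

  define Y where "Y i \<omega> = vec_of_complex (f (complex_of_real (X (Suc i) \<omega>)))" for i \<omega>
  define m where "m = expectation (\<lambda>\<omega>. f (complex_of_real (X 1 \<omega>)))"
  define h where "h v = vec_of_complex (inv_into U f (complex_of_vec v))" for v
  define J where "J = jacobian h (at (vec_of_complex m))"
  define S where "S = covariance_matrix M (Y 0)"
  have [measurable]: "Y i \<in> borel_measurable M" for i
    unfolding Y_def by measurable
  have int: "integrable M (\<lambda>\<omega>. (norm (Y 0 \<omega>))\<^sup>2)"
    using assms(13) by (simp add: Y_def)
  have int_f: "integrable M (\<lambda>\<omega>. f (complex_of_real (X 1 \<omega>)))"
    using assms(13) by (rule integrable_of_norm_square[rotated]) measurable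
  have mean: "expectation (Y 0) = vec_of_complex m"
    using integral_bounded_linear[OF bounded_linear_vec_of_complex int_f] by (simp add: Y_def[abs_def] m_def)

  \<comment> \<open>The absence of atoms enters here: the one real point at which \<open>f\<close>
    may be uncontrolled is avoided almost surely.\<close>
  have "AE \<omega> in M. X 1 \<omega> \<noteq> Re \<alpha>"
    using assms(12)[of 1 "Re \<alpha>"] by (subst prob_Collect_eq_0[symmetric]) auto
  then have "AE \<omega> in M. f (complex_of_real (X 1 \<omega>)) \<in> f ` ({z. 0 \<le> Im z} - {\<alpha>})"
    by eventually_elim (intro imageI real_in_half_plane)
  then have "m \<in> f ` ({z. 0 \<le> Im z} - {\<alpha>})"
    unfolding m_def by (intro expectation_in_convex int_f assms(8))
  then have "m \<in> f ` U"
    using assms(5) by blast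
  then have "inv_into U f field_differentiable at m"
    using inverse(1) open_mapping_thm3[OF assms(6,2,7)] by (simp add: holomorphic_on_imp_differentiable_at)
  then obtain d where "(inv_into U f has_derivative (*) d) (at m)"
    by (auto simp: field_differentiable_def has_field_derivative_def)
  then have "(inv_into U f has_derivative (*) d) (at (complex_of_vec (vec_of_complex m)))"
    by simp
  from bounded_linear.has_derivative[OF bounded_linear_vec_of_complex
      has_derivative_compose[OF bounded_linear_imp_has_derivative[OF bounded_linear_complex_of_vec] this]]
  have "h differentiable at (vec_of_complex m)"
    unfolding h_def by (rule differentiableI)
  then have deriv: "(h has_derivative ((*v) J)) (at (expectation (Y 0)))"
    unfolding mean J_def by (rule jacobian_works[THEN iffD1])
  have [measurable]: "h \<in> borel_measurable borel"
    unfolding h_def by measurable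

  have "range Suc = {1..}"
    by (auto simp: Suc_le_eq gr0_conv_Suc)
  then have "indep_vars (\<lambda>_. borel) X (range Suc)"
    using assms(10) by (simp only:)
  from indep_vars_reindex[OF this] have "indep_vars (\<lambda>_. borel) (\<lambda>i. X (Suc i)) UNIV"
    by simp
  then have indep: "indep_vars (\<lambda>_. borel) Y UNIV"
    unfolding Y_def[abs_def]
    by (rule indep_vars_compose2[where Y = "\<lambda>_ x. vec_of_complex (f (complex_of_real x))"]) measurable
  have "distr M borel (Y i) = distr (distr M borel (X (Suc i))) borel (\<lambda>x. vec_of_complex (f (complex_of_real x)))" for i
    by (simp add: distr_distr comp_def Y_def[abs_def])
  then have distr: "distr M borel (Y i) = distr M borel (Y 0)" for i
    using assms(11)[of "Suc i"] by simp
  have "S $ 1 $ 2 = S $ 2 $ 1"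
    by (simp add: S_def covariance_matrix_def mult.commute)
  moreover have "0 \<le> t \<bullet> (S *v t)" for t
    unfolding S_def using int by (subst covariance_matrix_quadratic_form) auto
  ultimately obtain A :: "real^2^2" where A: "A ** transpose A = S"
    using psd_matrix_root_2 by blast
  \<comment> \<open>Shows that the target covariance has a root as well, so that
    \<open>char_multivariate_normal\<close> applies to the claimed limit law.\<close>
  then have JA: "(J ** A) ** transpose (J ** A) = J ** S ** transpose J"
    by (simp add: matrix_transpose_mul flip: A matrix_mul_assoc)

  define V where "V n \<omega> = (\<Sum>i<n. Y i \<omega> - expectation (Y 0)) /\<^sub>R sqrt n" for n \<omega>
  define W where "W n \<omega> = sqrt n *\<^sub>R (h (expectation (Y 0) + V n \<omega> /\<^sub>R sqrt n) - h (expectation (Y 0)))" for n \<omega>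
  have "converges_in_distribution M V (multivariate_normal 0 S)"
    using multivariate_central_limit_theorem[OF indep distr int, of A] A by (simp add: S_def V_def[abs_def])
  then have conv: "converges_in_distribution M W (distr (multivariate_normal 0 S) borel ((*v) J))"
    unfolding W_def
    by (rule delta_method[OF _ prob_space_multivariate_normal sets_multivariate_normal _ deriv])
      (auto intro: filterlim_compose[OF sqrt_at_top filterlim_real_sequentially])

  \<comment> \<open>The delta method yields the image of \<open>multivariate_normal 0 S\<close>
    under \<open>J\<close>. Its character at \<open>t\<close> is the original one at
    \<open>transpose J *v t\<close>, whose quadratic form is that of
    \<open>J ** S ** transpose J\<close> at \<open>t\<close>.\<close>
  have limit: "converges_in_distribution M W (multivariate_normal 0 (J ** S ** transpose J))"
  proof (rule levy_continuity_euclidean[OF _ prob_space_multivariate_normal sets_multivariate_normal])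
    show "W n \<in> borel_measurable M" for n
      using conv by (simp add: converges_in_distribution_def)
    fix t :: "real^2"
    note [measurable_cong] = sets_multivariate_normal
    have [measurable]: "(*v) J \<in> borel_measurable borel"
      by (intro borel_measurable_continuous_onI linear_continuous_on) simp
    have J_measurable: "(*v) J \<in> borel_measurable (multivariate_normal 0 S)"
      by measurable
    have adj: "t \<bullet> (J *v x) = (transpose J *v t) \<bullet> x" for x
      by (simp only: transpose_matrix_vector dot_lmul_matrix)
    have "(\<lambda>n. CLINT \<omega>|M. iexp (t \<bullet> W n \<omega>))
        \<longlonglongrightarrow> (CLINT y|distr (multivariate_normal 0 S) borel ((*v) J). iexp (t \<bullet> y))"
      using conv
      by (rule char_convergence)
        (simp_all add: prob_space.prob_space_distr prob_space_multivariate_normal J_measurable)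
    also have "(CLINT y|distr (multivariate_normal 0 S) borel ((*v) J). iexp (t \<bullet> y))
        = (CLINT y|multivariate_normal 0 S. iexp ((transpose J *v t) \<bullet> y))"
      by (simp add: integral_distr J_measurable adj)
    also have "\<dots> = (CLINT y|multivariate_normal 0 (J ** S ** transpose J). iexp (t \<bullet> y))"
      by (simp add: char_multivariate_normal[OF A] char_multivariate_normal[OF JA]
          matrix_vector_mul_assoc[symmetric] adj)
    finally show "(\<lambda>n. CLINT \<omega>|M. iexp (t \<bullet> W n \<omega>))
        \<longlonglongrightarrow> (CLINT y|multivariate_normal 0 (J ** S ** transpose J). iexp (t \<bullet> y))" .
  qed
  have "W n \<omega> = sqrt n *\<^sub>R
      (vec_of_complex (inv_into U f ((\<Sum>j=1..n. f (complex_of_real (X j \<omega>))) / of_nat n))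
        - vec_of_complex (inv_into U f m))" for n \<omega>
  \<comment> \<open>At \<open>n = 0\<close> the arguments of the inverse need not agree, since
    division by zero gives 0 and not the mean; the factor \<open>sqrt 0\<close> makes both sides
    vanish.\<close>
  proof (cases "n = 0")
    case False
    \<comment> \<open>One square root comes from the normalisation in \<open>V\<close>, the other
      from the scale of the delta method; together they give the average.\<close>
    have root: "v /\<^sub>R sqrt (real n) /\<^sub>R sqrt (real n) = v /\<^sub>R real n" for v :: "real^2"
      by (simp flip: inverse_mult_distrib)
    have "expectation (Y 0) + V n \<omega> /\<^sub>R sqrt n = (\<Sum>i<n. Y i \<omega>) /\<^sub>R n"
      unfolding V_def root
      using False by (simp add: sum_subtractf scaleR_diff_right sum_constant_scaleR del: sum_constant)
    also have "\<dots> = vec_of_complex ((\<Sum>i<n. f (complex_of_real (X (Suc i) \<omega>))) /\<^sub>R n)"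
      using bounded_linear_vec_of_complex
      by (simp add: Y_def linear_sum linear_scale bounded_linear.linear o_def)
    also have "(\<Sum>i<n. f (complex_of_real (X (Suc i) \<omega>))) /\<^sub>R n
        = (\<Sum>j=1..n. f (complex_of_real (X j \<omega>))) / of_nat n"
      by (simp add: sum.atLeast1_atMost_eq scaleR_conv_of_real divide_inverse mult.commute)
    finally show ?thesis
      by (simp add: W_def h_def mean)
  qed (simp add: W_def)
  then have "W = (\<lambda>n \<omega>. sqrt n *\<^sub>R
      (vec_of_complex (inv_into U f ((\<Sum>j=1..n. f (complex_of_real (X j \<omega>))) / of_nat n))
        - vec_of_complex (inv_into U f m)))"
    by (intro ext)
  with limit show ?thesis
    by (simp add: Let_def J_def h_def[abs_def] S_def Y_def[abs_def] m_def)
qed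

end
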